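(* Let $\lambda\ge 0$ and $a_\lambda\ge 0$ be some prespecified constants. If $(\bar{\mathbf{x}}_T-\bar{\mathbf{x}}_C)\,|\,\mathbf{x}\sim\mathcal{N}(0,\mathbf{\Sigma})$ and $N_T=N_C$, then ridge rerandomization reduces the variance of the $k$-th covariate mean difference $(\bar{\mathbf{x}}_T-\bar{\mathbf{x}}_C)_k$ by $100(1-v_{k,\lambda})\%$, where $$v_{k,\lambda}=\frac{\big(\mathbf{\Gamma}\,\mathbf{Diag}((\lambda_j\,d_{j,\lambda})_{1\le j\le K})\,\mathbf{\Gamma}^\top\big)_{kk}}{\mathbf{\Sigma}_{kk}}$$ satisfies $v_{k,\lambda}\in(0,1)$, so that $$\mathrm{Var}\big((\bar{\mathbf{x}}_T-\bar{\mathbf{x}}_C)_k\,|\,\mathbf{x},M_\lambda\le a_\lambda\big)\;<\;\mathrm{Var}\big((\bar{\mathbf{x}}_T-\bar{\mathbf{x}}_C)_k\,|\,\mathbf{x}\big).$$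
   Context: $\mathbf{x}$ is the real $N\times K$ matrix of $K$ covariates measured on $N$ experimental units. In a completely randomized experiment, a fixed number $N_T$ of units is assigned to treatment and $N_C=N-N_T$ to control; $W_i=1$ if unit $i$ is assigned to treatment and $W_i=0$ otherwise, and $\mathbf{W}=(W_1,\dots,W_N)^\top$ is the random assignment vector. The covariate mean vectors in treatment and control are $\bar{\mathbf{x}}_T=N_T^{-1}\mathbf{x}^\top\mathbf{W}$ and $\bar{\mathbf{x}}_C=N_C^{-1}\mathbf{x}^\top(\mathbf{1}_N-\mathbf{W})$, where $\mathbf{1}_N$ is the all-ones column vector. $\mathbf{\Sigma}=\mathrm{Cov}(\bar{\mathbf{x}}_T-\bar{\mathbf{x}}_C\,|\,\mathbf{x})=\frac{N}{N_TN_C}S^2_{\mathbf{x}}$ is the covariance matrix of the covariate mean differences under complete randomization, where $S^2_{\mathbf{x}}=(N-1)^{-1}(\mathbf{x}-\mathbf{1}_N\bar{\mathbf{x}}_N)^\top(\mathbf{x}-\mathbf{1}_N\bar{\mathbf{x}}_N)$ and $\bar{\mathbf{x}}_N=N^{-1}\mathbf{1}_N^\top\mathbf{x}$. $\mathbf{\Sigma}$ is assumed positive definite, with spectral decomposition $\mathbf{\Sigma}=\mathbf{\Gamma}\,\mathbf{Diag}(\lambda_1,\dots,\lambda_K)\,\mathbf{\Gamma}^\top$, where $\lambda_1\ge\dots\ge\lambda_K>0$ are the eigenvalues and $\mathbf{\Gamma}$ is the orthogonal matrix of corresponding eigenvectors; $\mathbf{Diag}$ of a $K$-tuple is the diagonal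 matrix with those entries. The ridge Mahalanobis distance is $M_\lambda=(\bar{\mathbf{x}}_T-\bar{\mathbf{x}}_C)^\top(\mathbf{\Sigma}+\lambda\,\mathbf{I}_K)^{-1}(\bar{\mathbf{x}}_T-\bar{\mathbf{x}}_C)$, with $\mathbf{I}_K$ the identity matrix. Ridge rerandomization means drawing the assignment vector $\mathbf{W}$ repeatedly and independently until $M_\lambda\le a_\lambda$, i.e. conditioning on $M_\lambda\le a_\lambda$; variance reduction is relative to complete randomization (no conditioning on $M_\lambda$). For $k=1,\dots,K$, $d_{k,\lambda}=\mathbb{E}\big[Z_k^2\,\big|\,\sum_{j=1}^K\frac{\lambda_j}{\lambda_j+\lambda}Z_j^2\le a_\lambda\big]$ with $Z_1,\dots,Z_K$ i.i.d. $\mathcal{N}(0,1)$.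
   Formalization: The threshold is taken to satisfy a_λ > 0 instead of a_λ ≥ 0: at a_λ = 0 the event M_λ ≤ a_λ has probability zero, so the conditional variance and d_{k,λ} are undefined, and in the limit v_{k,λ} = 0, outside (0,1). *)

theory Defs
  imports "HOL-Probability.Probability"
begin

text \<open>
  A type \<open>'n\<close> indexes the experimental units and a type \<open>'k\<close> the covariates, so
  that \<open>N = CARD('n)\<close> and \<open>K = CARD('k)\<close>; \<open>x $ i $ j\<close> is covariate \<open>j\<close> of unit \<open>i\<close>.
  The matrix \<open>x\<close> is fixed throughout, which is what conditioning on it amounts to: all the
  randomness is in the assignment.
\<close>

definition diag_matrix :: "real^'k \<Rightarrow> real^'k^'k" where
  "diag_matrix v = (\<chi> i j. if i = j then v $ i else 0)"

definition positive_definite :: "real^'k^'k \<Rightarrow> bool" where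
  "positive_definite A \<longleftrightarrow> transpose A = A \<and> (\<forall>v. v \<noteq> 0 \<longrightarrow> 0 < v \<bullet> (A *v v))"

definition spectral_decomposition :: "real^'k^'k \<Rightarrow> real^'k^'k \<Rightarrow> real^'k \<Rightarrow> bool" where
  "spectral_decomposition A \<Gamma> l \<longleftrightarrow>
     orthogonal_matrix \<Gamma> \<and> A = \<Gamma> ** diag_matrix l ** transpose \<Gamma>"

definition normal_vector_density :: "real^'k \<Rightarrow> real^'k^'k \<Rightarrow> real^'k \<Rightarrow> real" where
  "normal_vector_density \<mu> A y =
     exp (- ((y - \<mu>) \<bullet> (matrix_inv A *v (y - \<mu>))) / 2) / sqrt ((2 * pi) ^ CARD('k) * det A)"

definition covariate_mean :: "real^'k^'n \<Rightarrow> real^'k" where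
  "covariate_mean x = (1 / real CARD('n)) *\<^sub>R (1 v* x)"

definition sample_covariance :: "real^'k^'n \<Rightarrow> real^'k^'k" where
  "sample_covariance x =
     (let xc = (\<chi> i. x $ i - covariate_mean x)
      in (1 / (real CARD('n) - 1)) *\<^sub>R (transpose xc ** xc))"

definition mean_diff_cov :: "real^'k^'n \<Rightarrow> nat \<Rightarrow> nat \<Rightarrow> real^'k^'k" where
  "mean_diff_cov x N\<^sub>T N\<^sub>C = (real CARD('n) / (real N\<^sub>T * real N\<^sub>C)) *\<^sub>R sample_covariance x"

text \<open>
  The assignment vector \<open>w\<close> is an element of \<open>real^'n\<close>, of which the 0/1 vectors with
  \<open>N\<^sub>T\<close> ones are a special case. A random assignment with only 0/1 values has finitely many
  values, and then the mean difference cannot have the exact normal law that serves as an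
  idealization of its large-sample law; for real-valued assignments that law is possible.
\<close>

definition treatment_mean :: "real^'k^'n \<Rightarrow> nat \<Rightarrow> real^'n \<Rightarrow> real^'k" where
  "treatment_mean x N\<^sub>T w = (1 / real N\<^sub>T) *\<^sub>R (transpose x *v w)"

definition control_mean :: "real^'k^'n \<Rightarrow> nat \<Rightarrow> real^'n \<Rightarrow> real^'k" where
  "control_mean x N\<^sub>C w = (1 / real N\<^sub>C) *\<^sub>R (transpose x *v (1 - w))"

definition mean_diff :: "real^'k^'n \<Rightarrow> nat \<Rightarrow> nat \<Rightarrow> real^'n \<Rightarrow> real^'k" where
  "mean_diff x N\<^sub>T N\<^sub>C w = treatment_mean x N\<^sub>T w - control_mean x N\<^sub>C w"

definition ridge_mahalanobis :: "real^'k^'n \<Rightarrow> nat \<Rightarrow> nat \<Rightarrow> real \<Rightarrow> real^'n \<Rightarrow> real" where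
  "ridge_mahalanobis x N\<^sub>T N\<^sub>C lam w =
     mean_diff x N\<^sub>T N\<^sub>C w \<bullet>
       (matrix_inv (mean_diff_cov x N\<^sub>T N\<^sub>C + lam *\<^sub>R mat 1) *v mean_diff x N\<^sub>T N\<^sub>C w)"

text \<open>
  Conditioning on an event \<open>A\<close> of positive probability is integration with respect to
  \<open>uniform_measure P A\<close>, the measure \<open>B \<mapsto> P (A \<inter> B) / P A\<close>.
\<close>

definition ridge_rerandomized ::
    "'a measure \<Rightarrow> ('a \<Rightarrow> real^'n) \<Rightarrow> real^'k^'n \<Rightarrow> nat \<Rightarrow> nat \<Rightarrow> real \<Rightarrow> real \<Rightarrow> 'a measure" where
  "ridge_rerandomized P W x N\<^sub>T N\<^sub>C lam a =
     uniform_measure P {\<omega> \<in> space P. ridge_mahalanobis x N\<^sub>T N\<^sub>C lam (W \<omega>) \<le> a}"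

definition ridge_d :: "real^'k \<Rightarrow> real \<Rightarrow> real \<Rightarrow> 'k \<Rightarrow> real" where
  "ridge_d l lam a k =
     (let Z = PiM UNIV (\<lambda>_::'k. density lborel std_normal_density);
          A = {z \<in> space Z. (\<Sum>j\<in>UNIV. l $ j / (l $ j + lam) * (z j)\<^sup>2) \<le> a}
      in prob_space.expectation (uniform_measure Z A) (\<lambda>z. (z k)\<^sup>2))"

definition ridge_v ::
    "real^'k^'k \<Rightarrow> real^'k^'k \<Rightarrow> real^'k \<Rightarrow> real \<Rightarrow> real \<Rightarrow> 'k \<Rightarrow> real" where
  "ridge_v A \<Gamma> l lam a k =
     (\<Gamma> ** diag_matrix (\<chi> j. l $ j * ridge_d l lam a j) ** transpose \<Gamma>) $ k $ k / A $ k $ k"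

definition percent_reduction :: "real \<Rightarrow> real \<Rightarrow> real" where
  "percent_reduction old new = 100 * ((old - new) / old)"

end

theory Submission
  imports Defs
begin

text \<open>
  In the eigenbasis of \<open>\<Sigma>\<close>, the mean difference is \<open>\<Gamma>\<close> applied to the vector with entries
  \<open>sqrt (l $ j) * z j\<close>, with independent standard normal \<open>z j\<close>, and the acceptance event is the
  ellipsoid \<open>(\<Sum>j. l $ j / (l $ j + lam) * (z j)\<^sup>2) \<le> a\<close>. The ellipsoid is symmetric under the
  sign change of any one coordinate, so under conditioning all means and cross moments vanish and the
  variance of the \<open>k\<close>-th mean difference is
  \<open>\<Sum>j. (\<Gamma> $ k $ j)\<^sup>2 * l $ j * ridge_d l lam a j\<close>. Finally \<open>0 < ridge_d l lam a j < 1\<close>: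
  with the other coordinates fixed, the ellipsoid cuts out an interval \<open>{-r..r}\<close>, and the
  integral of \<open>1 - y\<^sup>2\<close> against the standard normal density \<open>\<phi>\<close> over it is
  \<open>2 * r * \<phi> r > 0\<close>.
\<close>

subsection \<open>Invariance of Lebesgue measure and product densities\<close>

text \<open>
  Two translation-invariant measures are compared by evaluating the double integral of
  \<open>indicator B y * indicator A (y + x)\<close> in both orders, where \<open>B\<close> is the unit ball.
\<close>

lemma lborel_eqI_translation_invariant:
  fixes M :: "'a::euclidean_space measure"
  assumes sets_M[measurable_cong, simp]: "sets M = sets borel"
    and sf: "sigma_finite_measure M"
    and inv: "\<And>c. distr M borel (\<lambda>x. c + x) = M"
    and ball: "emeasure M (ball 0 1) = emeasure lborel (ball (0::'a) 1)"
  shows "M = lborel"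
proof (rule measure_eqI)
  fix A assume "A \<in> sets M"
  then have A[measurable]: "A \<in> sets borel" by simp
  interpret M: sigma_finite_measure M by fact
  interpret pair_sigma_finite M "lborel :: 'a measure" ..
  define B where "B = ball (0::'a) 1"
  have B[measurable]: "B \<in> sets borel" by (simp add: B_def)
  \<comment> \<open>In the last inner integral \<open>x\<close> enters as \<open>y - x\<close>, so
    shifting by \<open>y\<close> leaves \<open>B (- x)\<close>; the symmetry of the ball removes the
    sign.\<close>
  have B_uminus: "indicator B (- x) = indicator B x" for x by (simp add: B_def indicator_def)
  have pair[measurable_cong]: "sets (M \<Otimes>\<^sub>M (lborel :: 'a measure)) = sets (borel \<Otimes>\<^sub>M borel)"
    by (intro sets_pair_measure_cong) auto
  have sp: "space M = UNIV" using sets_eq_imp_space_eq[OF sets_M] by simp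
  have "emeasure lborel A * emeasure M B = (\<integral>\<^sup>+y. indicator B y * (\<integral>\<^sup>+x. indicator A x \<partial>lborel) \<partial>M)"
  proof -
    have "B \<in> sets M" "A \<in> sets lborel" using A B by simp_all
    then show ?thesis
      using nn_integral_cmult_indicator[of B M "emeasure lborel A"] by (simp add: mult.commute)
  qed
  also have "\<dots> = (\<integral>\<^sup>+y. indicator B y * (\<integral>\<^sup>+x. indicator A (y + x) \<partial>lborel) \<partial>M)"
  proof (rule nn_integral_cong)
    fix y
    have "(\<integral>\<^sup>+x. indicator A x \<partial>lborel) = (\<integral>\<^sup>+x. indicator A x \<partial>distr lborel borel ((+) y))"
      by (simp add: lborel_distr_plus)
    also have "\<dots> = (\<integral>\<^sup>+x. indicator A (y + x) \<partial>lborel)"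
      by (subst nn_integral_distr) auto
    finally show "indicator B y * (\<integral>\<^sup>+x. indicator A x \<partial>lborel) =
        indicator B y * (\<integral>\<^sup>+x. indicator A (y + x) \<partial>lborel)" by simp
  qed
  also have "\<dots> = (\<integral>\<^sup>+y. (\<integral>\<^sup>+x. indicator B y * indicator A (y + x) \<partial>lborel) \<partial>M)"
    by (intro nn_integral_cong nn_integral_cmult[symmetric]) auto
  also have "\<dots> = (\<integral>\<^sup>+x. (\<integral>\<^sup>+y. indicator B y * indicator A (y + x) \<partial>M) \<partial>lborel)"
    by (rule Fubini'[symmetric]) measurable
  \<comment> \<open>For fixed \<open>x\<close>, invariance of \<open>M\<close> moves the shift from
    \<open>A\<close> to \<open>B\<close>, so that after swapping back the integral in
    \<open>x\<close> involves the ball alone.\<close>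
  also have "\<dots> = (\<integral>\<^sup>+x. (\<integral>\<^sup>+y. indicator B (y - x) * indicator A y \<partial>M) \<partial>lborel)"
  proof (rule nn_integral_cong)
    fix x
    have "(\<integral>\<^sup>+y. indicator B (y - x) * indicator A y \<partial>M) =
        (\<integral>\<^sup>+y. indicator B (y - x) * indicator A y \<partial>distr M borel (\<lambda>y. x + y))"
      by (simp add: inv)
    also have "\<dots> = (\<integral>\<^sup>+y. indicator B y * indicator A (y + x) \<partial>M)"
      by (subst nn_integral_distr) (auto simp: add.commute)
    finally show "(\<integral>\<^sup>+y. indicator B y * indicator A (y + x) \<partial>M) =
        (\<integral>\<^sup>+y. indicator B (y - x) * indicator A y \<partial>M)" by simp
  qed
  also have "\<dots> = (\<integral>\<^sup>+y. (\<integral>\<^sup>+x. indicator B (y - x) * indicator A y \<partial>lborel) \<partial>M)"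
    by (rule Fubini') measurable
  also have "\<dots> = (\<integral>\<^sup>+y. emeasure lborel B * indicator A y \<partial>M)"
  proof (rule nn_integral_cong)
    fix y
    have "(\<integral>\<^sup>+x. indicator B (y - x) * indicator A y \<partial>lborel) =
        (\<integral>\<^sup>+x. indicator B (y - x) \<partial>lborel) * indicator A y"
      by (rule nn_integral_multc) auto
    also have "(\<integral>\<^sup>+x. indicator B (y - x) \<partial>lborel) =
        (\<integral>\<^sup>+x. indicator B (y - x) \<partial>distr lborel borel ((+) y))"
      by (simp add: lborel_distr_plus)
    also have "\<dots> = (\<integral>\<^sup>+x. indicator B x \<partial>lborel)"
      by (subst nn_integral_distr) (auto simp: B_uminus)
    finally show "(\<integral>\<^sup>+x. indicator B (y - x) * indicator A y \<partial>lborel) =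
        emeasure lborel B * indicator A y" by simp
  qed
  also have "\<dots> = emeasure M A * emeasure lborel B"
    by (subst nn_integral_cmult) (auto simp: mult.commute)
  finally have eq: "emeasure lborel A * emeasure lborel B = emeasure M A * emeasure lborel B"
    by (simp add: ball B_def)
  \<comment> \<open>Cancelling the common factor in \<open>ennreal\<close> requires the volume of
    the ball to be positive and finite.\<close>
  have "emeasure lborel B \<noteq> 0"
    using emeasure_lborel_ball_finite[of "0::'a" 1] content_ball_pos[of 1 "0::'a"]
    by (auto simp: measure_def B_def)
  moreover have "emeasure lborel B \<noteq> \<top>"
    using emeasure_lborel_ball_finite[of "0::'a" 1] by (simp add: B_def)
  ultimately show "emeasure M A = emeasure lborel A"
    using eq by (simp add: ennreal_mult_cancel_left mult.commute[of _ "emeasure lborel B"])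
qed simp

text \<open>
  The library lemma \<open>measure_linear_image\<close> is restricted to vectors with a \<open>wellorder\<close> index
  type, which the covariate index is not; translation invariance avoids that restriction.
\<close>

lemma lborel_distr_orthogonal:
  fixes f :: "'a::euclidean_space \<Rightarrow> 'a"
  assumes f: "orthogonal_transformation f"
  shows "distr lborel borel f = lborel"
proof -
  have lin: "linear f" using f by (rule orthogonal_transformation_linear)
  have [measurable]: "f \<in> borel_measurable borel"
    by (intro borel_measurable_continuous_onI linear_continuous_on linear_conv_bounded_linear[THEN iffD1] lin)
  have nf: "norm (f x) = norm x" for x
    using f by (simp add: orthogonal_transformation)
  \<comment> \<open>\<open>f\<close> preserves norms, so a centred ball is its own preimage. Radius
    1 gives the normalization, integer radii give sigma-finiteness.\<close>
  have ball: "emeasure (distr lborel borel f) (ball 0 r) = emeasure lborel (ball (0::'a) r)" for r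
    by (subst emeasure_distr) (auto simp: vimage_def ball_def nf dist_norm)
  show ?thesis
  proof (rule lborel_eqI_translation_invariant)
    show "sigma_finite_measure (distr lborel borel f)"
    proof (rule sigma_finite_measure.intro, intro exI conjI)
      show "countable (range (\<lambda>n::nat. ball (0::'a) (real n)))" by simp
      show "range (\<lambda>n. ball 0 (real n)) \<subseteq> sets (distr lborel borel f)" by auto
      show "\<Union> (range (\<lambda>n. ball 0 (real n))) = space (distr lborel borel f)"
        by (auto intro: reals_Archimedean2)
      show "\<forall>a\<in>range (\<lambda>n. ball 0 (real n)). emeasure (distr lborel borel f) a \<noteq> \<infinity>"
        using emeasure_lborel_ball_finite by (auto simp: ball less_top[symmetric])
    qed
    fix c
    \<comment> \<open>A shift by \<open>c\<close> after \<open>f\<close> equals a shift by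
      \<open>d\<close> before \<open>f\<close>, and Lebesgue measure absorbs the latter.\<close>
    obtain d where d: "f d = c" using orthogonal_transformation_surj[OF f] by (metis surjD)
    have "distr (distr lborel borel f) borel (\<lambda>x. c + x) = distr lborel borel (\<lambda>x. f (d + x))"
      by (subst distr_distr) (auto simp: comp_def d linear_add[OF lin])
    also have "\<dots> = distr (distr lborel borel ((+) d)) borel f"
      by (subst distr_distr) (auto simp: comp_def)
    finally show "distr (distr lborel borel f) borel (\<lambda>x. c + x) = distr lborel borel f"
      by (simp add: lborel_distr_plus)
  qed (use ball[of 1] in simp_all)
qed

text \<open>The preimage of a box under a coordinatewise map is again a box, and boxes determine a
  finite product measure. Probability measures are used because the image of a sigma-finite measure
  may fail to be sigma-finite.\<close>

lemma distr_PiM_coordinatewise: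
  assumes fin: "finite I"
    and M: "\<And>i. prob_space (M i)"
    and f[measurable]: "\<And>i. f i \<in> measurable (M i) (M' i)"
  shows "distr (PiM I M) (PiM I M') (\<lambda>x. \<lambda>i\<in>I. f i (x i)) = PiM I (\<lambda>i. distr (M i) (M' i) (f i))"
proof (rule product_sigma_finite.PiM_eqI)
  interpret M: product_prob_space M using M by (intro product_prob_spaceI)
  have N: "prob_space (distr (M i) (M' i) (f i))" for i
    using M by (intro prob_space.prob_space_distr) auto
  then interpret N: product_prob_space "\<lambda>i. distr (M i) (M' i) (f i)" by (intro product_prob_spaceI)
  show "product_sigma_finite (\<lambda>i. distr (M i) (M' i) (f i))" ..
  fix A assume A: "\<And>i. i \<in> I \<Longrightarrow> A i \<in> sets (distr (M i) (M' i) (f i))"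
  have "emeasure (distr (PiM I M) (PiM I M') (\<lambda>x. \<lambda>i\<in>I. f i (x i))) (Pi\<^sub>E I A) =
      emeasure (PiM I M) ((\<lambda>x. \<lambda>i\<in>I. f i (x i)) -` Pi\<^sub>E I A \<inter> space (PiM I M))"
    using A fin by (intro emeasure_distr sets_PiM_I_finite) auto
  also have "(\<lambda>x. \<lambda>i\<in>I. f i (x i)) -` Pi\<^sub>E I A \<inter> space (PiM I M) = Pi\<^sub>E I (\<lambda>i. f i -` A i \<inter> space (M i))"
    by (auto simp: space_PiM PiE_def Pi_def extensional_def)
  also have "emeasure (PiM I M) \<dots> = (\<Prod>i\<in>I. emeasure (M i) (f i -` A i \<inter> space (M i)))"
    using A by (intro M.emeasure_PiM fin) auto
  also have "\<dots> = (\<Prod>i\<in>I. emeasure (distr (M i) (M' i) (f i)) (A i))"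
    using A by (intro prod.cong refl emeasure_distr[symmetric]) auto
  finally show "emeasure (distr (PiM I M) (PiM I M') (\<lambda>x. \<lambda>i\<in>I. f i (x i))) (Pi\<^sub>E I A) =
      (\<Prod>i\<in>I. emeasure (distr (M i) (M' i) (f i)) (A i))" .
qed (use fin in \<open>auto intro!: sets_PiM_cong\<close>)

text \<open>On a box the integrand is a product of functions of one coordinate each, so Tonelli's
  theorem splits the integral into factors.\<close>

lemma PiM_density:
  assumes fin: "finite I"
    and M: "product_sigma_finite M"
    and N: "\<And>i. sigma_finite_measure (density (M i) (g i))"
    and g[measurable]: "\<And>i. g i \<in> borel_measurable (M i)"
  shows "PiM I (\<lambda>i. density (M i) (g i)) = density (PiM I M) (\<lambda>x. \<Prod>i\<in>I. g i (x i))"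
proof (rule product_sigma_finite.PiM_eqI[symmetric])
  interpret M: product_sigma_finite M by fact
  show "product_sigma_finite (\<lambda>i. density (M i) (g i))"
    using N by (simp add: product_sigma_finite_def)
  fix A assume A: "\<And>i. i \<in> I \<Longrightarrow> A i \<in> sets (density (M i) (g i))"
  have "emeasure (density (PiM I M) (\<lambda>x. \<Prod>i\<in>I. g i (x i))) (Pi\<^sub>E I A) =
      (\<integral>\<^sup>+x. (\<Prod>i\<in>I. g i (x i)) * indicator (Pi\<^sub>E I A) x \<partial>PiM I M)"
    using A fin by (intro emeasure_density sets_PiM_I_finite) auto
  also have "\<dots> = (\<integral>\<^sup>+x. (\<Prod>i\<in>I. g i (x i) * indicator (A i) (x i)) \<partial>PiM I M)"
  proof (rule nn_integral_cong)
    fix x assume "x \<in> space (PiM I M)"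
    then have "indicator (Pi\<^sub>E I A) x = (\<Prod>i\<in>I. indicator (A i) (x i) :: ennreal)"
      using fin by (auto simp: indicator_def space_PiM PiE_def Pi_def)
    then show "(\<Prod>i\<in>I. g i (x i)) * indicator (Pi\<^sub>E I A) x = (\<Prod>i\<in>I. g i (x i) * indicator (A i) (x i))"
      by (simp add: prod.distrib)
  qed
  also have "\<dots> = (\<Prod>i\<in>I. \<integral>\<^sup>+x. g i x * indicator (A i) x \<partial>M i)"
    using A fin by (intro M.product_nn_integral_prod) auto
  also have "\<dots> = (\<Prod>i\<in>I. emeasure (density (M i) (g i)) (A i))"
    using A by (intro prod.cong refl emeasure_density[symmetric]) auto
  finally show "emeasure (density (PiM I M) (\<lambda>x. \<Prod>i\<in>I. g i (x i))) (Pi\<^sub>E I A) =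
      (\<Prod>i\<in>I. emeasure (density (M i) (g i)) (A i))" .
qed (use fin in \<open>auto intro!: sets_PiM_cong\<close>)

section \<open>Lebesgue measure on vectors as a product measure\<close>

lemma measurable_vec_lambda[measurable]:
  "vec_lambda \<in> borel_measurable (PiM UNIV (\<lambda>_::'n::finite. borel :: real measure))"
proof -
  have "(\<lambda>x. vec_lambda x \<bullet> b) \<in> borel_measurable (PiM UNIV (\<lambda>_::'n. borel :: real measure))"
    if "b \<in> Basis" for b :: "real^'n"
    using that by (auto simp: Basis_vec_def inner_axis)
  then show ?thesis by (rule borel_measurable_euclidean_space[THEN iffD2, rule_format])
qed

lemma measurable_vec_nth[measurable]:
  "(\<lambda>x :: real^'n::finite. x $ i) \<in> borel_measurable borel"
  by (intro borel_measurable_continuous_onI continuous_intros)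

text \<open>Links the functions on which \<open>PiM\<close> lives with the type of vectors on which
  the normal density is stated; both measures give an open box the product of its side
  lengths.\<close>

lemma distr_PiM_lborel_vec:
  "distr (PiM UNIV (\<lambda>_::'n::finite. lborel)) borel (\<lambda>x. \<chi> i. x i) = (lborel :: (real^'n) measure)"
proof (rule lborel_eqI[symmetric])
  interpret product_sigma_finite "\<lambda>_::'n. lborel :: real measure" ..
  have "sets (PiM UNIV (\<lambda>_::'n. lborel :: real measure)) = sets (PiM UNIV (\<lambda>_::'n. borel))"
    by (intro sets_PiM_cong) auto
  from measurable_cong_sets[OF this refl]
  have [measurable]: "vec_lambda \<in> PiM UNIV (\<lambda>_::'n. lborel :: real measure) \<rightarrow>\<^sub>M borel"
    using measurable_vec_lambda by blast
  fix a b :: "real^'n" assume le: "\<And>i. i \<in> Basis \<Longrightarrow> a \<bullet> i \<le> b \<bullet> i"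
  have le': "a $ i \<le> b $ i" for i using le[of "axis i 1"] by (simp add: inner_axis axis_in_Basis_iff)
  have "emeasure (distr (PiM UNIV (\<lambda>_::'n. lborel)) borel (\<lambda>x. \<chi> i. x i)) (box a b) =
     emeasure (PiM UNIV (\<lambda>_::'n. lborel)) (Pi\<^sub>E UNIV (\<lambda>i. {a $ i <..< b $ i}))"
    by (subst emeasure_distr)
       (auto simp: mem_box_cart space_PiM PiE_def Pi_def intro!: arg_cong2[where f=emeasure])
  also have "\<dots> = (\<Prod>i\<in>UNIV. ennreal (b $ i - a $ i))"
    using le' by (subst emeasure_PiM) auto
  also have "\<dots> = ennreal (\<Prod>i\<in>UNIV. b $ i - a $ i)"
    using le' by (intro prod_ennreal) (simp add: algebra_simps)
  also have "(\<Prod>i\<in>UNIV. b $ i - a $ i) = (\<Prod>i\<in>Basis. (b - a) \<bullet> i)"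
  proof -
    have B: "Basis = range (\<lambda>i::'n. axis i (1::real))" by (auto simp: Basis_vec_def)
    have "inj (\<lambda>i::'n. axis i (1::real))" by (auto simp: inj_def axis_eq_axis)
    then show ?thesis unfolding B by (simp add: prod.reindex inner_axis)
  qed
  finally show "emeasure (distr (PiM UNIV (\<lambda>_::'n. lborel)) borel (\<lambda>x. \<chi> i. x i)) (box a b) =
    ennreal (\<Prod>i\<in>Basis. (b - a) \<bullet> i)" .
qed simp

subsection \<open>Symmetries and moments of the standard Gaussian\<close>

text \<open>Used with \<open>s = -1\<close> for reflections and with \<open>s = sqrt (l $ i)\<close>
  for scaling to variance \<open>l $ i\<close>; the absolute value serves the negative case.\<close>

lemma std_normal_distr_mult:
  assumes "s \<noteq> 0"
  shows "distr std_normal_distribution lborel (\<lambda>x. s * x) = density lborel (normal_density 0 \<bar>s\<bar>)"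
proof -
  interpret N: prob_space std_normal_distribution
    by (rule prob_space_normal_density) simp
  have "distributed std_normal_distribution lborel (\<lambda>x. x) std_normal_density"
    unfolding distributed_def by (auto simp: distr_id2)
  from N.normal_density_affine[OF this, of s 0] assms
  have "distributed std_normal_distribution lborel (\<lambda>x. s * x) (normal_density 0 \<bar>s\<bar>)" by simp
  then show ?thesis by (rule distributed_distr_eq_density)
qed

text \<open>The index set is a parameter because the slicing argument also needs the product over
  \<open>UNIV - {j}\<close>.\<close>

abbreviation std_gauss :: "'i set \<Rightarrow> ('i \<Rightarrow> real) measure" where
  "std_gauss I \<equiv> PiM I (\<lambda>_. std_normal_distribution)"

lemma sets_std_gauss[measurable_cong]: "sets (std_gauss I) = sets (PiM I (\<lambda>_. borel))"
  by (intro sets_PiM_cong) auto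

lemma prob_space_std_normal: "prob_space std_normal_distribution"
  by (rule prob_space_normal_density) simp

lemma prob_space_std_gauss: "prob_space (std_gauss I)"
  by (intro prob_space_PiM prob_space_std_normal)

definition flip :: "'i \<Rightarrow> ('i \<Rightarrow> real) \<Rightarrow> 'i \<Rightarrow> real" where
  "flip j z = (\<lambda>i. if i = j then - z i else z i)"

lemma flip_square: "(flip i z j)\<^sup>2 = (z j)\<^sup>2"
  by (simp add: flip_def)

lemma measurable_flip[measurable]: "flip j \<in> PiM UNIV (\<lambda>_. borel) \<rightarrow>\<^sub>M PiM UNIV (\<lambda>_. borel)"
  unfolding flip_def by (rule measurable_PiM_single') (auto simp: space_PiM)

text \<open>Independence reduces the claim to single coordinates, where a sign change leaves the
  even standard normal density as it is.\<close>

lemma distr_std_gauss_flip: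
  fixes j :: "'i::finite"
  shows "distr (std_gauss UNIV) (std_gauss UNIV) (flip j) = std_gauss UNIV"
proof -
  let ?f = "\<lambda>i x. (if i = j then -1 else 1) * (x::real)"
  have "distr (std_gauss UNIV) (PiM UNIV (\<lambda>_. lborel)) (\<lambda>z. \<lambda>i\<in>UNIV. ?f i (z i)) =
      PiM UNIV (\<lambda>i. distr std_normal_distribution lborel (?f i))"
    by (intro distr_PiM_coordinatewise prob_space_std_normal) auto
  also have "\<dots> = std_gauss UNIV"
    by (intro PiM_cong refl, subst std_normal_distr_mult) auto
  also have "distr (std_gauss UNIV) (PiM UNIV (\<lambda>_. lborel)) (\<lambda>z. \<lambda>i\<in>UNIV. ?f i (z i)) =
      distr (std_gauss UNIV) (std_gauss UNIV) (flip j)"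
    by (intro distr_cong sets_PiM_cong refl) (auto simp: flip_def fun_eq_iff)
  finally show ?thesis .
qed

text \<open>Reflecting coordinate \<open>j\<close> keeps the measure and negates \<open>h\<close>,
  so the integral equals its own negative. A nonintegrable \<open>h\<close> is covered too, its
  integral being 0 by convention.\<close>

lemma integral_std_gauss_odd:
  fixes h :: "('i::finite \<Rightarrow> real) \<Rightarrow> real"
  assumes h: "\<And>z. h (flip j z) = - h z" and [measurable]: "h \<in> borel_measurable (PiM UNIV (\<lambda>_. borel))"
  shows "(\<integral>z. h z \<partial>std_gauss UNIV) = 0"
proof -
  have "(\<integral>z. h z \<partial>std_gauss UNIV) = (\<integral>z. h z \<partial>distr (std_gauss UNIV) (std_gauss UNIV) (flip j))"
    by (simp add: distr_std_gauss_flip)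
  also have "\<dots> = (\<integral>z. h (flip j z) \<partial>std_gauss UNIV)"
    by (rule integral_distr) auto
  finally show ?thesis by (simp add: h)
qed

lemma
  assumes "i \<in> I"
  shows integrable_std_gauss_square: "integrable (std_gauss I) (\<lambda>z. (z i)\<^sup>2)"
    and integral_std_gauss_square: "(\<integral>z. (z i)\<^sup>2 \<partial>std_gauss I) = 1"
proof -
  have d: "distr (std_gauss I) std_normal_distribution (\<lambda>z. z i) = std_normal_distribution"
    using assms by (intro distr_PiM_component prob_space_std_normal)
  have [measurable]: "(\<lambda>z. z i) \<in> std_gauss I \<rightarrow>\<^sub>M std_normal_distribution"
    using assms by measurable
  have [simp]: "(\<lambda>z. z i) \<in> borel_measurable (std_gauss I)"
    using assms by measurable
  show "integrable (std_gauss I) (\<lambda>z. (z i)\<^sup>2)"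
    using std_normal_distribution_even_moments(2)[of 1] integrable_distr[of "\<lambda>z. z i" "std_gauss I" std_normal_distribution power2]
    by (simp add: d)
  show "(\<integral>z. (z i)\<^sup>2 \<partial>std_gauss I) = 1"
    using std_normal_distribution_even_moments(1)[of 1]
    by (subst (asm) d[symmetric]) (simp add: integral_distr)
qed

text \<open>\<open>z j\<close> is odd in coordinate \<open>j\<close>, and so is
  \<open>z i * z j\<close> for \<open>i \<noteq> j\<close>, while the indicator of a
  reflection-invariant set is even; only the squares survive. Applied to \<open>UNIV\<close> for
  complete randomization and to the acceptance ellipsoid for rerandomization.\<close>

lemma integral_std_gauss_linear_form:
  fixes b :: "'i::finite \<Rightarrow> real"
  assumes flip: "\<And>i z. flip i z \<in> B \<longleftrightarrow> z \<in> B" and B: "B \<in> sets (PiM UNIV (\<lambda>_. borel))"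
  shows "(\<integral>z. indicator B z * (\<Sum>j\<in>UNIV. b j * z j) \<partial>std_gauss UNIV) = 0" (is ?th1)
    and "(\<integral>z. indicator B z * (\<Sum>j\<in>UNIV. b j * z j)\<^sup>2 \<partial>std_gauss UNIV) =
      (\<Sum>j\<in>UNIV. (b j)\<^sup>2 * (\<integral>z. indicator B z * (z j)\<^sup>2 \<partial>std_gauss UNIV))" (is ?th2)
proof -
  note B[measurable]
  interpret prob_space "std_gauss (UNIV :: 'i set)" by (rule prob_space_std_gauss)
  have ind: "indicator B (flip i z) = (indicator B z :: real)" for i z
    by (simp add: indicator_def flip)
  have int1: "integrable (std_gauss UNIV) (\<lambda>z. indicator B z * z j)" for j :: 'i
  proof (rule Bochner_Integration.integrable_bound)
    show "integrable (std_gauss UNIV) (\<lambda>z. 1 + (z j)\<^sup>2)"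
      by (intro Bochner_Integration.integrable_add integrable_std_gauss_square) auto
    show "AE z in std_gauss UNIV. norm (indicator B z * z j) \<le> norm (1 + (z j)\<^sup>2)"
    proof (rule AE_I2)
      fix z :: "'i \<Rightarrow> real"
      \<comment> \<open>Gives \<open>2 * \<bar>z j\<bar> \<le> 1 + (z j)\<^sup>2\<close>, hence an
        integrable majorant built from second moments alone.\<close>
      have "0 \<le> (\<bar>z j\<bar> - 1)\<^sup>2" by simp
      also have "(\<bar>z j\<bar> - 1)\<^sup>2 = (z j)\<^sup>2 + 1 - 2 * \<bar>z j\<bar>" by (simp add: power2_eq_square algebra_simps)
      finally show "norm (indicator B z * z j) \<le> norm (1 + (z j)\<^sup>2)"
        by (auto simp: indicator_def)
    qed
  qed measurable
  have int2: "integrable (std_gauss UNIV) (\<lambda>z. indicator B z * (z i * z j))" for i j :: 'i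
  proof (rule Bochner_Integration.integrable_bound)
    show "integrable (std_gauss UNIV) (\<lambda>z. (z i)\<^sup>2 + (z j)\<^sup>2)"
      by (intro Bochner_Integration.integrable_add integrable_std_gauss_square) auto
    show "AE z in std_gauss UNIV. norm (indicator B z * (z i * z j)) \<le> norm ((z i)\<^sup>2 + (z j)\<^sup>2)"
    proof (rule AE_I2)
      fix z :: "'i \<Rightarrow> real"
      have "0 \<le> (\<bar>z i\<bar> - \<bar>z j\<bar>)\<^sup>2" by simp
      also have "(\<bar>z i\<bar> - \<bar>z j\<bar>)\<^sup>2 = (z i)\<^sup>2 + (z j)\<^sup>2 - 2 * \<bar>z i * z j\<bar>"
        by (simp add: power2_eq_square algebra_simps abs_mult)
      finally show "norm (indicator B z * (z i * z j)) \<le> norm ((z i)\<^sup>2 + (z j)\<^sup>2)"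
        by (auto simp: indicator_def)
    qed
  qed measurable
  have odd1: "(\<integral>z. indicator B z * z j \<partial>std_gauss UNIV) = 0" for j :: 'i
    by (rule integral_std_gauss_odd[of _ j]) (auto simp: ind, simp add: flip_def)
  have odd2: "(\<integral>z. indicator B z * (z i * z j) \<partial>std_gauss UNIV) = 0" if "i \<noteq> j" for i j :: 'i
    by (rule integral_std_gauss_odd[of _ j]) (use that in \<open>auto simp: ind, simp add: flip_def\<close>)
  have "(\<integral>z. indicator B z * (\<Sum>j\<in>UNIV. b j * z j) \<partial>std_gauss UNIV) =
      (\<integral>z. (\<Sum>j\<in>UNIV. b j * (indicator B z * z j)) \<partial>std_gauss UNIV)"
    by (simp add: sum_distrib_left mult_ac)
  also have "\<dots> = (\<Sum>j\<in>UNIV. b j * (\<integral>z. indicator B z * z j \<partial>std_gauss UNIV))"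
    using int1 by (subst Bochner_Integration.integral_sum) auto
  finally show ?th1 by (simp add: odd1)
  have "(\<integral>z. indicator B z * (\<Sum>j\<in>UNIV. b j * z j)\<^sup>2 \<partial>std_gauss UNIV) =
      (\<integral>z. (\<Sum>i\<in>UNIV. \<Sum>j\<in>UNIV. b i * b j * (indicator B z * (z i * z j))) \<partial>std_gauss UNIV)"
    by (simp add: power2_eq_square sum_product sum_distrib_left mult_ac)
  also have "\<dots> = (\<Sum>i\<in>UNIV. \<Sum>j\<in>UNIV. b i * b j * (\<integral>z. indicator B z * (z i * z j) \<partial>std_gauss UNIV))"
    using int2 by (simp add: Bochner_Integration.integral_sum)
  also have "\<dots> = (\<Sum>i\<in>UNIV. \<Sum>j\<in>UNIV. if j = i
      then (b i)\<^sup>2 * (\<integral>z. indicator B z * (z i)\<^sup>2 \<partial>std_gauss UNIV) else 0)"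
    by (intro sum.cong refl) (auto simp: odd2 power2_eq_square)
  finally show ?th2 by simp
qed

section \<open>Conditioning and truncation\<close>

lemma integral_uniform_measure:
  fixes f :: "'a \<Rightarrow> real"
  assumes "prob_space M" and [measurable]: "A \<in> sets M" "f \<in> borel_measurable M"
    and pos: "measure M A > 0"
  shows "(\<integral>x. f x \<partial>uniform_measure M A) = (\<integral>x. indicator A x * f x \<partial>M) / measure M A"
proof -
  interpret prob_space M by fact
  \<comment> \<open>The \<open>ennreal\<close> quotient becomes a real density, to which the rule
    for Bochner integrals applies; \<open>pos\<close> excludes division by zero.\<close>
  have "uniform_measure M A = density M (\<lambda>x. ennreal (indicator A x / measure M A))"
    unfolding uniform_measure_def
    using divide_ennreal[of 1 "measure M A"] pos
    by (intro density_cong AE_I2) (auto simp: emeasure_eq_measure indicator_def)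
  then have "(\<integral>x. f x \<partial>uniform_measure M A) = (\<integral>x. (indicator A x * f x) / measure M A \<partial>M)"
    by (simp add: integral_density)
  then show ?thesis by simp
qed

text \<open>The derivative of the density \<phi> at y is - y \<phi> y, so y \<phi> y is an
  antiderivative of the integrand and the integral over a symmetric interval is explicit.\<close>

lemma std_normal_truncation_reduces_second_moment:
  assumes "c > 0" "t > 0"
  shows "(\<integral>y. indicator {y. c * y\<^sup>2 \<le> t} y * (1 - y\<^sup>2) \<partial>std_normal_distribution) > 0"
proof -
  define r where "r = sqrt (t / c)"
  have r: "r > 0" using assms by (simp add: r_def)
  have set: "{y. c * y\<^sup>2 \<le> t} = {-r..r}"
  proof -
    have r2: "r\<^sup>2 = t / c" using assms by (simp add: r_def)
    have "c * y\<^sup>2 \<le> t \<longleftrightarrow> y\<^sup>2 \<le> r\<^sup>2" for y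
      using assms by (simp add: r2 field_simps)
    then have "c * y\<^sup>2 \<le> t \<longleftrightarrow> \<bar>y\<bar> \<le> \<bar>r\<bar>" for y
      unfolding abs_le_square_iff by blast
    moreover have "\<bar>y\<bar> \<le> \<bar>r\<bar> \<longleftrightarrow> y \<in> {-r..r}" for y
      unfolding atLeastAtMost_iff using r by linarith
    ultimately show ?thesis by blast
  qed
  have phi: "std_normal_density = (\<lambda>y. 1 / sqrt (2 * pi) * exp (- y\<^sup>2 / 2))"
    by (simp add: fun_eq_iff std_normal_density_def)
  have "(\<integral>y. indicator {-r..r} y *\<^sub>R (std_normal_density y * (1 - y\<^sup>2)) \<partial>lborel) =
      r * std_normal_density r - (- r) * std_normal_density (- r)"
  proof (rule integral_FTC_Icc)
    show "- r \<le> r" using r by simp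
    fix y
    have "((\<lambda>y. exp (- y\<^sup>2 / 2)) has_real_derivative exp (- y\<^sup>2 / 2) * (- y)) (at y within {-r..r})"
      by (auto intro!: derivative_eq_intros)
    from DERIV_cmult[OF this, of "1 / sqrt (2 * pi)"]
    have "(std_normal_density has_real_derivative std_normal_density y * (- y)) (at y within {-r..r})"
      unfolding phi mult.assoc .
    from DERIV_mult[OF DERIV_ident this]
    show "((\<lambda>y. y * std_normal_density y) has_vector_derivative std_normal_density y * (1 - y\<^sup>2))
        (at y within {-r..r})"
      unfolding has_real_derivative_iff_has_vector_derivative[symmetric]
      by (rule DERIV_cong) (simp add: algebra_simps power2_eq_square)
  next
    show "continuous_on {-r..r} (\<lambda>y. std_normal_density y * (1 - y\<^sup>2))"
      unfolding normal_density_def by (intro continuous_intros) auto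
  qed
  also have "\<dots> > 0" using r by (simp add: normal_density_def)
  finally show ?thesis
    unfolding set by (subst integral_density) (auto simp: mult_ac)
qed

text \<open>A small cube fits inside the ellipsoid and has positive mass by independence. The
  inequality is strict so that points of the set leave a slice of positive length for one more
  coordinate; \<open>I\<close> may be empty, which happens with a single covariate.\<close>

lemma std_gauss_ellipsoid_pos:
  fixes c :: "'i \<Rightarrow> real"
  assumes fin: "finite I" and c: "\<And>i. c i \<ge> 0" and a: "a > 0"
  shows "measure (std_gauss I) {z \<in> space (std_gauss I). (\<Sum>i\<in>I. c i * (z i)\<^sup>2) < a} > 0"
proof -
  interpret N: prob_space std_normal_distribution by (rule prob_space_std_normal)
  interpret G: finite_product_prob_space "\<lambda>_::'i. std_normal_distribution" I
    by standard fact
  \<comment> \<open>The added 1 keeps \<open>C\<close> positive when all \<open>c i\<close> vanish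
    and makes the bound \<open>(C - 1) * (a / C)\<close> strictly smaller than
    \<open>a\<close>.\<close>
  define C where "C = (\<Sum>i\<in>I. c i) + 1"
  have C: "C > 0" using c by (simp add: C_def add_nonneg_pos sum_nonneg)
  define e where "e = sqrt (a / C)"
  have e: "e > 0" "e\<^sup>2 = a / C" using a C by (simp_all add: e_def)
  \<comment> \<open>The density vanishes nowhere, so a null interval would also be Lebesgue null,
    although its length is positive.\<close>
  have int: "measure std_normal_distribution {-e<..<e} > 0"
  proof (rule ccontr)
    assume "\<not> ?thesis"
    then have "measure std_normal_distribution {-e<..<e} = 0"
      by (simp add: zero_less_measure_iff)
    then have "{-e<..<e} \<in> null_sets std_normal_distribution"
      by (auto simp: null_sets_def N.emeasure_eq_measure)
    then have "AE x in lborel. x \<in> {-e<..<e} \<longrightarrow> std_normal_density x = 0"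
      by (simp add: null_sets_density_iff)
    then have "AE x in lborel. x \<notin> {-e<..<e}"
      by eventually_elim (metis less_irrefl normal_density_pos zero_less_one)
    then have "{-e<..<e} \<in> null_sets lborel"
      by (subst AE_iff_null_sets) auto
    then show False using e by (simp add: null_sets_def)
  qed
  have "0 < (\<Prod>i\<in>I. measure std_normal_distribution {-e<..<e})"
    using int by (simp add: prod_pos)
  also have "\<dots> = measure (std_gauss I) (Pi\<^sub>E I (\<lambda>_. {-e<..<e}))"
    using fin by (subst G.prob_times) auto
  also have "\<dots> \<le> measure (std_gauss I) {z \<in> space (std_gauss I). (\<Sum>i\<in>I. c i * (z i)\<^sup>2) < a}"
  proof (rule G.finite_measure_mono, safe)
    fix z assume z: "z \<in> Pi\<^sub>E I (\<lambda>_. {-e<..<e})"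
    then show "z \<in> space (std_gauss I)" by (auto simp: space_PiM)
    have "(\<Sum>i\<in>I. c i * (z i)\<^sup>2) \<le> (\<Sum>i\<in>I. c i * e\<^sup>2)"
    proof (intro sum_mono mult_left_mono c)
      fix i assume "i \<in> I"
      then have "\<bar>z i\<bar> \<le> \<bar>e\<bar>" using z by (force simp: PiE_iff)
      then show "(z i)\<^sup>2 \<le> e\<^sup>2" by (simp only: abs_le_square_iff)
    qed
    also have "\<dots> = (C - 1) * (a / C)" by (simp only: sum_distrib_right[symmetric] e(2)) (simp add: C_def)
    also have "\<dots> < a" using a C by (simp add: field_simps)
    finally show "(\<Sum>i\<in>I. c i * (z i)\<^sup>2) < a" .
  qed measurable
  finally show ?thesis .
qed

subsection \<open>The multivariate normal density in an eigenbasis\<close>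

text \<open>Replaces computing the inverse by exhibiting a preimage of \<open>y\<close>.\<close>

lemma matrix_inv_mult_vec:
  fixes A :: "real^'n^'n"
  assumes "invertible A" "A *v x = y"
  shows "matrix_inv A *v y = x"
proof -
  have "matrix_inv A ** A = mat 1"
    using someI_ex[OF assms(1)[unfolded invertible_def]] by (simp add: matrix_inv_def)
  then show ?thesis
    unfolding assms(2)[symmetric] by (simp add: matrix_vector_mul_assoc)
qed

lemma diag_matrix_mult_vec: "diag_matrix l *v u = (\<chi> i. l $ i * u $ i)"
  by (simp add: vec_eq_iff diag_matrix_def matrix_vector_mult_def if_distrib[of "\<lambda>x. x * _"] cong: if_cong)

lemma det_diag_matrix: "det (diag_matrix l) = (\<Prod>i\<in>UNIV. l $ i)"
  by (subst det_diagonal) (auto simp: diag_matrix_def)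

lemma conjugated_diag_entry:
  "(\<Gamma> ** diag_matrix l ** transpose \<Gamma>) $ k $ k = (\<Sum>j\<in>UNIV. (\<Gamma> $ k $ j)\<^sup>2 * l $ j)"
  by (simp add: matrix_matrix_mult_def transpose_def diag_matrix_def if_distrib[of "\<lambda>x. _ * x"]
      power2_eq_square mult_ac cong: if_cong)

lemma orthogonal_matrix_cancel:
  fixes \<Gamma> :: "real^'n^'n"
  assumes "orthogonal_matrix \<Gamma>"
  shows "transpose \<Gamma> *v (\<Gamma> *v u) = u" "(\<Gamma> *v u) \<bullet> (\<Gamma> *v w) = u \<bullet> w"
proof -
  show "transpose \<Gamma> *v (\<Gamma> *v u) = u"
    using assms unfolding matrix_vector_mul_assoc orthogonal_matrix_def by simp
  show "(\<Gamma> *v u) \<bullet> (\<Gamma> *v w) = u \<bullet> w"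
    using assms orthogonal_transformation_matrix[of "(*v) \<Gamma>"]
    by (simp add: orthogonal_transformation_def)
qed

text \<open>\<open>det \<Gamma>\<close> is 1 or -1 and occurs twice.\<close>

lemma spectral_decomposition_det:
  assumes "spectral_decomposition A \<Gamma> l"
  shows "det A = (\<Prod>i\<in>UNIV. l $ i)"
  using assms det_orthogonal_matrix[of \<Gamma>]
  by (auto simp: spectral_decomposition_def det_mul det_transpose det_diag_matrix)

text \<open>A multiple of the identity is unchanged by conjugation with \<open>\<Gamma>\<close>, so
  the eigenvectors stay and the eigenvalues move by \<open>c\<close>; hence the ridge distance is
  diagonal in the eigenbasis of the covariance matrix.\<close>

lemma spectral_decomposition_shift:
  fixes A :: "real^'a^'a"
  assumes "spectral_decomposition A \<Gamma> l"
  shows "spectral_decomposition (A + c *\<^sub>R mat 1) \<Gamma> (\<chi> i. l $ i + c)"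
proof -
  have \<Gamma>: "orthogonal_matrix \<Gamma>" and A: "A = \<Gamma> ** diag_matrix l ** transpose \<Gamma>"
    using assms by (auto simp: spectral_decomposition_def)
  have "diag_matrix (\<chi> i. l $ i + c) = diag_matrix l + c *\<^sub>R mat 1"
    by (simp add: vec_eq_iff diag_matrix_def mat_def)
  moreover have rdistrib: "(B + C) ** D = B ** D + C ** D" for B C D :: "real^'a^'a"
    by (simp add: vec_eq_iff matrix_matrix_mult_def distrib_right sum.distrib)
  moreover have scale: "(c *\<^sub>R B) ** D = c *\<^sub>R (B ** D)" for B D :: "real^'a^'a"
    by (simp add: vec_eq_iff matrix_matrix_mult_def sum_distrib_left mult_ac)
  ultimately have "\<Gamma> ** diag_matrix (\<chi> i. l $ i + c) ** transpose \<Gamma> = A + c *\<^sub>R (\<Gamma> ** transpose \<Gamma>)"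
    by (simp add: A matrix_add_ldistrib rdistrib matrix_scalar_ac scale)
  then show ?thesis using \<Gamma> by (simp add: spectral_decomposition_def orthogonal_matrix_def)
qed

text \<open>Serves twice: for the exponent of the normal density and, after the shift, for the ridge
  distance.\<close>

lemma spectral_decomposition_matrix_inv:
  assumes A: "spectral_decomposition A \<Gamma> l" and l: "\<And>i. l $ i \<noteq> 0"
  shows "(\<Gamma> *v u) \<bullet> (matrix_inv A *v (\<Gamma> *v u)) = (\<Sum>i\<in>UNIV. (u $ i)\<^sup>2 / l $ i)"
proof -
  have \<Gamma>: "orthogonal_matrix \<Gamma>" and A_eq: "A = \<Gamma> ** diag_matrix l ** transpose \<Gamma>"
    using A by (auto simp: spectral_decomposition_def)
  have "invertible A"
    using l by (simp add: invertible_det_nz spectral_decomposition_det[OF A])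
  moreover have "A *v (\<Gamma> *v (\<chi> i. u $ i / l $ i)) = \<Gamma> *v u"
    unfolding A_eq using l
    by (simp add: matrix_vector_mul_assoc[symmetric] orthogonal_matrix_cancel[OF \<Gamma>] diag_matrix_mult_vec
        del: transpose_matrix_vector)
  ultimately have "matrix_inv A *v (\<Gamma> *v u) = \<Gamma> *v (\<chi> i. u $ i / l $ i)"
    by (rule matrix_inv_mult_vec)
  then show ?thesis
    by (simp only: orthogonal_matrix_cancel[OF \<Gamma>]) (simp add: inner_vec_def power2_eq_square)
qed

lemma measurable_matrix_vector_mult[measurable]:
  "(*v) A \<in> borel_measurable borel" for A :: "real^'n^'m"
  by (intro borel_measurable_continuous_onI matrix_vector_mult_linear_continuous_on)

text \<open>In the eigenbasis the quadratic form is a sum of squares and the determinant a product,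
  so the joint density factors over the coordinates.\<close>

lemma normal_vector_density_rotate:
  fixes A :: "real^'k^'k"
  assumes A: "spectral_decomposition A \<Gamma> l" and l: "\<And>i. l $ i > 0"
  shows "normal_vector_density 0 A (\<Gamma> *v u) = (\<Prod>i\<in>UNIV. normal_density 0 (sqrt (l $ i)) (u $ i))"
proof -
  have "normal_vector_density 0 A (\<Gamma> *v u) =
      exp (\<Sum>i\<in>UNIV. - ((u $ i)\<^sup>2 / l $ i) / 2) / sqrt (\<Prod>i\<in>UNIV. 2 * pi * l $ i)"
    unfolding normal_vector_density_def using l
    by (simp add: spectral_decomposition_matrix_inv[OF A] less_imp_neq[symmetric] spectral_decomposition_det[OF A]
        prod.distrib sum_negf sum_divide_distrib)
  also have "sqrt (\<Prod>i\<in>UNIV. 2 * pi * l $ i) = (\<Prod>i\<in>UNIV. sqrt (2 * pi * l $ i))"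
    by (induction rule: infinite_finite_induct) (auto simp: real_sqrt_mult)
  finally show ?thesis
    using l by (simp add: normal_density_def exp_sum prod_dividef less_imp_le mult_ac)
qed

subsection \<open>Second moments on an ellipsoid\<close>

text \<open>Divided by the probability of \<open>A\<close>, these facts say that the constants
  \<open>ridge_d\<close> lie strictly between 0 and 1. The upper bound integrates
  \<open>1 - (z j)\<^sup>2\<close> over \<open>A\<close>, coordinate \<open>j\<close> first.\<close>

lemma std_gauss_ellipsoid_second_moment:
  fixes c :: "'i::finite \<Rightarrow> real"
  assumes c: "\<And>i. c i > 0" and a: "a > 0"
  defines "A \<equiv> {z \<in> space (std_gauss UNIV). (\<Sum>i\<in>UNIV. c i * (z i)\<^sup>2) \<le> a}"
  shows "measure (std_gauss UNIV) A > 0"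
    and "(\<integral>z. indicator A z * (z j)\<^sup>2 \<partial>std_gauss UNIV) > 0"
    and "(\<integral>z. indicator A z * (z j)\<^sup>2 \<partial>std_gauss UNIV) < measure (std_gauss UNIV) A"
proof -
  interpret N: prob_space std_normal_distribution by (rule prob_space_std_normal)
  interpret P: product_sigma_finite "\<lambda>_::'i. std_normal_distribution" ..
  interpret G: prob_space "std_gauss (UNIV :: 'i set)" by (rule prob_space_std_gauss)
  have sp: "space (std_gauss UNIV) = (UNIV :: ('i \<Rightarrow> real) set)" by (simp add: space_PiM)
  have A[measurable]: "A \<in> sets (std_gauss UNIV)" unfolding A_def by measurable
  show pos: "measure (std_gauss UNIV) A > 0"
  proof (rule less_le_trans)
    show "measure (std_gauss UNIV) {z \<in> space (std_gauss UNIV). (\<Sum>i\<in>UNIV. c i * (z i)\<^sup>2) < a} > 0"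
      using c a by (intro std_gauss_ellipsoid_pos) (auto intro: less_imp_le)
    show "measure (std_gauss UNIV) {z \<in> space (std_gauss UNIV). (\<Sum>i\<in>UNIV. c i * (z i)\<^sup>2) < a} \<le>
        measure (std_gauss UNIV) A"
      by (intro G.finite_measure_mono A) (auto simp: A_def)
  qed
  have int: "integrable (std_gauss UNIV) (\<lambda>z. indicator A z * (z j)\<^sup>2)"
    using integrable_mult_indicator[OF A integrable_std_gauss_square[of j UNIV]] by simp
  show "(\<integral>z. indicator A z * (z j)\<^sup>2 \<partial>std_gauss UNIV) > 0"
  proof (rule ccontr)
    assume "\<not> ?thesis"
    then have "(\<integral>z. indicator A z * (z j)\<^sup>2 \<partial>std_gauss UNIV) = 0"
      by (intro antisym Bochner_Integration.integral_nonneg) auto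
    then have "AE z in std_gauss UNIV. indicator A z * (z j)\<^sup>2 = 0"
      using int by (subst (asm) integral_nonneg_eq_0_iff_AE) auto
    \<comment> \<open>The hyperplane \<open>z j = 0\<close> is null, so a vanishing integral would
      make \<open>A\<close> itself null.\<close>
    moreover have "AE z in std_gauss UNIV. z j \<noteq> 0"
    proof (rule AE_PiM_component)
      show "AE y in std_normal_distribution. y \<noteq> 0"
        using AE_lborel_singleton[of "0::real"] by (subst AE_density) auto
    qed (auto intro: prob_space_std_normal)
    ultimately have "AE z in std_gauss UNIV. z \<notin> A"
      by eventually_elim (auto simp: indicator_def)
    then have "measure (std_gauss UNIV) A = 0"
      using A by (subst (asm) AE_iff_null_sets[symmetric]) (auto simp: null_sets_def measure_def)
    then show False using pos by simp
  qed
  let ?I = "UNIV - {j}"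
  interpret GI: prob_space "std_gauss ?I" by (rule prob_space_std_gauss)
  \<comment> \<open>\<open>r x\<close> is the part of the bound used up by the other coordinates,
    and \<open>g (a - r x)\<close> is the integral over the slice that remains.\<close>
  define g where "g t = (\<integral>y. indicator {y. c j * y\<^sup>2 \<le> t} y * (1 - y\<^sup>2) \<partial>std_normal_distribution)" for t
  define r where "r x = (\<Sum>i\<in>?I. c i * (x i)\<^sup>2)" for x :: "'i \<Rightarrow> real"
  have r[measurable]: "r \<in> borel_measurable (std_gauss ?I)" unfolding r_def by measurable
  have sq: "integrable std_normal_distribution (\<lambda>y. y\<^sup>2)"
    using std_normal_distribution_even_moments(2)[of 1] by simp
  have g_meas[measurable]: "g \<in> borel_measurable borel"
  proof -
    \<comment> \<open>The set under the indicator depends on \<open>t\<close>; written with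
      \<open>if\<close>, the integrand is jointly measurable in \<open>t\<close> and
      \<open>y\<close>.\<close>
    have "(\<lambda>t. \<integral>y. (if c j * y\<^sup>2 \<le> t then 1 - y\<^sup>2 else 0) \<partial>std_normal_distribution) \<in> borel_measurable borel"
      by measurable
    also have "(\<lambda>t. \<integral>y. (if c j * y\<^sup>2 \<le> t then 1 - y\<^sup>2 else 0) \<partial>std_normal_distribution) = g"
      unfolding g_def by (intro ext Bochner_Integration.integral_cong) auto
    finally show ?thesis .
  qed
  have g_pos: "g t > 0" if "t > 0" for t
    unfolding g_def using c that by (rule std_normal_truncation_reduces_second_moment)
  have g_nonneg: "g t \<ge> 0" for t
  proof (cases "t > 0")
    case False
    \<comment> \<open>For \<open>t \<le> 0\<close> the slice contains at most \<open>y = 0\<close>,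
      where \<open>1 - y\<^sup>2\<close> is 1.\<close>
    have zero: "y = 0" if "c j * y\<^sup>2 \<le> t" for y
      using that False c[of j] by (smt (verit) mult_pos_pos zero_less_power2)
    then show ?thesis
      unfolding g_def by (intro Bochner_Integration.integral_nonneg) (auto simp: indicator_def dest!: zero)
  qed (use g_pos in \<open>auto intro: less_imp_le\<close>)
  \<comment> \<open>A bound independent of \<open>t\<close> makes \<open>g (a - r x)\<close>
    integrable in \<open>x\<close>.\<close>
  have g_bound: "\<bar>g t\<bar> \<le> (\<integral>y. 1 + y\<^sup>2 \<partial>std_normal_distribution)" for t
  proof -
    have "\<bar>g t\<bar> \<le> (\<integral>y. \<bar>indicator {y. c j * y\<^sup>2 \<le> t} y * (1 - y\<^sup>2)\<bar> \<partial>std_normal_distribution)"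
      unfolding g_def by (rule integral_abs_bound)
    also have "\<dots> \<le> (\<integral>y. 1 + y\<^sup>2 \<partial>std_normal_distribution)"
      using sq by (intro integral_mono') (auto simp: indicator_def abs_if)
    finally show ?thesis .
  qed
  have intA: "integrable (std_gauss UNIV) (\<lambda>z. indicator A z :: real)"
    by (intro G.integrable_const_bound[of _ 1]) (auto simp: indicator_def)
  then have int1: "integrable (std_gauss UNIV) (\<lambda>z. indicator A z * (1 - (z j)\<^sup>2))"
    using int by (simp add: right_diff_distrib)
  have "(\<integral>z. indicator A z * (1 - (z j)\<^sup>2) \<partial>std_gauss UNIV) =
      (\<integral>x. (\<integral>y. indicator A (x(j := y)) * (1 - ((x(j := y)) j)\<^sup>2) \<partial>std_normal_distribution) \<partial>std_gauss ?I)"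
  proof -
    have "insert j ?I = UNIV" by auto
    then show ?thesis
      using P.product_integral_insert[of ?I j "\<lambda>z. indicator A z * (1 - (z j)\<^sup>2)"] int1 by simp
  qed
  also have "\<dots> = (\<integral>x. g (a - r x) \<partial>std_gauss ?I)"
  proof (rule Bochner_Integration.integral_cong[OF refl])
    fix x :: "'i \<Rightarrow> real"
    have "(\<Sum>i\<in>UNIV. c i * ((x(j := y)) i)\<^sup>2) = c j * y\<^sup>2 + r x" for y
    proof -
      have "(\<Sum>i\<in>UNIV. c i * ((x(j := y)) i)\<^sup>2) = c j * y\<^sup>2 + (\<Sum>i\<in>?I. c i * ((x(j := y)) i)\<^sup>2)"
        by (subst sum.remove[of _ j]) auto
      then show ?thesis by (simp add: r_def)
    qed
    then have "x(j := y) \<in> A \<longleftrightarrow> c j * y\<^sup>2 \<le> a - r x" for y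
      by (auto simp: A_def sp algebra_simps)
    then show "(\<integral>y. indicator A (x(j := y)) * (1 - ((x(j := y)) j)\<^sup>2) \<partial>std_normal_distribution) = g (a - r x)"
      unfolding g_def by (intro Bochner_Integration.integral_cong) (auto simp: indicator_def)
  qed
  \<comment> \<open>A zero integral would force \<open>g (a - r x) = 0\<close>, hence
    \<open>r x \<ge> a\<close>, almost everywhere, against the positive mass of the
    lower-dimensional ellipsoid \<open>r x < a\<close>.\<close>
  also have "\<dots> > 0"
  proof (rule ccontr)
    assume "\<not> ?thesis"
    then have "(\<integral>x. g (a - r x) \<partial>std_gauss ?I) = 0"
      by (intro antisym Bochner_Integration.integral_nonneg g_nonneg) auto
    moreover have "integrable (std_gauss ?I) (\<lambda>x. g (a - r x))"
      using g_bound by (intro GI.integrable_const_bound) auto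
    ultimately have "AE x in std_gauss ?I. g (a - r x) = 0"
      using g_nonneg by (subst (asm) integral_nonneg_eq_0_iff_AE) auto
    moreover have "\<not> r x < a" if "g (a - r x) = 0" for x
      using g_pos[of "a - r x"] that by linarith
    ultimately have "AE x in std_gauss ?I. x \<notin> {x \<in> space (std_gauss ?I). r x < a}"
      by (elim eventually_mono) blast
    then have "{x \<in> space (std_gauss ?I). r x < a} \<in> null_sets (std_gauss ?I)"
      by (subst AE_iff_null_sets) auto
    then have "measure (std_gauss ?I) {x \<in> space (std_gauss ?I). r x < a} = 0"
      by (auto simp: null_sets_def measure_def)
    moreover have "measure (std_gauss ?I) {x \<in> space (std_gauss ?I). r x < a} > 0"
      unfolding r_def using c a by (intro std_gauss_ellipsoid_pos) (auto intro: less_imp_le)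
    ultimately show False by simp
  qed
  also have "(\<integral>z. indicator A z * (1 - (z j)\<^sup>2) \<partial>std_gauss UNIV) =
      measure (std_gauss UNIV) A - (\<integral>z. indicator A z * (z j)\<^sup>2 \<partial>std_gauss UNIV)"
    using Bochner_Integration.integral_diff[OF intA int] A by (simp add: right_diff_distrib)
  finally show "(\<integral>z. indicator A z * (z j)\<^sup>2 \<partial>std_gauss UNIV) < measure (std_gauss UNIV) A" by simp
qed

text \<open>Turns the normality hypothesis into independent coordinates. Starting from the density,
  Lebesgue measure is rotated by \<open>\<Gamma>\<close>, the rotated density factors, and each
  factor is the law of a scaled standard normal variable.\<close>

lemma distr_std_gauss_spectral:
  fixes A :: "real^'k^'k"
  assumes A: "spectral_decomposition A \<Gamma> l" and l: "\<And>i. l $ i > 0"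
  shows "distr (std_gauss UNIV) borel (\<lambda>z. \<Gamma> *v (\<chi> i. sqrt (l $ i) * z i)) =
    density lborel (normal_vector_density 0 A)"
proof -
  have \<Gamma>: "orthogonal_transformation ((*v) \<Gamma>)"
    using A by (simp add: spectral_decomposition_def orthogonal_transformation_matrix)
  have [measurable]: "normal_vector_density 0 A \<in> borel_measurable borel"
    unfolding normal_vector_density_def by measurable
  have "density lborel (normal_vector_density 0 A) =
      density (distr lborel borel ((*v) \<Gamma>)) (normal_vector_density 0 A)"
    by (simp add: lborel_distr_orthogonal[OF \<Gamma>])
  also have "\<dots> = distr (density lborel (\<lambda>u. normal_vector_density 0 A (\<Gamma> *v u))) borel ((*v) \<Gamma>)"
    by (rule density_distr) measurable
  also have "density lborel (\<lambda>u. normal_vector_density 0 A (\<Gamma> *v u)) =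
      density (distr (PiM UNIV (\<lambda>_::'k. lborel)) borel vec_lambda)
        (\<lambda>u. \<Prod>i\<in>UNIV. ennreal (normal_density 0 (sqrt (l $ i)) (u $ i)))"
    by (simp add: distr_PiM_lborel_vec normal_vector_density_rotate[OF A l] prod_ennreal)
  also have "\<dots> = distr (density (PiM UNIV (\<lambda>_::'k. lborel))
      (\<lambda>u. \<Prod>i\<in>UNIV. ennreal (normal_density 0 (sqrt (l $ i)) (u i)))) borel vec_lambda"
    by (subst density_distr) auto
  also have "density (PiM UNIV (\<lambda>_::'k. lborel))
      (\<lambda>u. \<Prod>i\<in>UNIV. ennreal (normal_density 0 (sqrt (l $ i)) (u i))) =
      PiM UNIV (\<lambda>i. density lborel (normal_density 0 (sqrt (l $ i))))"
    using l
    by (intro PiM_density[symmetric] prob_space_imp_sigma_finite prob_space_normal_density)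
       (auto simp: product_sigma_finite_def lborel.sigma_finite_measure_axioms)
  also have "\<dots> = PiM UNIV (\<lambda>i. distr std_normal_distribution lborel (\<lambda>x. sqrt (l $ i) * x))"
    using l by (intro PiM_cong refl, subst std_normal_distr_mult) (auto simp: less_imp_neq[symmetric] less_imp_le)
  also have "\<dots> = distr (std_gauss UNIV) (PiM UNIV (\<lambda>_. lborel)) (\<lambda>z. \<lambda>i\<in>UNIV. sqrt (l $ i) * z i)"
    by (intro distr_PiM_coordinatewise[symmetric] prob_space_std_normal) auto
  \<comment> \<open>The three image measures compose: scaling, passage from functions to vectors,
    rotation.\<close>
  finally show ?thesis
    by (subst (asm) distr_distr, measurable) (subst (asm) distr_distr, measurable, simp add: comp_def restrict_UNIV)
qed

subsection \<open>Ridge rerandomization\<close>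

text \<open>The threshold is strictly positive: under the normal law the event that the distance is
  at most 0 is null, and \<open>uniform_measure\<close> on a null event is not a probability
  measure.\<close>

theorem corollary4p1:
  fixes P :: "'a measure"
    and W :: "'a \<Rightarrow> real^'n"
    and x :: "real^('k::{finite,linorder})^'n"
    and N\<^sub>T N\<^sub>C :: nat
    and \<Gamma> :: "real^('k::{finite,linorder})^('k::{finite,linorder})" and l :: "real^('k::{finite,linorder})"
    and lam a :: real and k :: 'k
  defines "\<Sigma> \<equiv> mean_diff_cov x N\<^sub>T N\<^sub>C"
    and "D \<equiv> \<lambda>\<omega>. mean_diff x N\<^sub>T N\<^sub>C (W \<omega>)"
    and "Q \<equiv> ridge_rerandomized P W x N\<^sub>T N\<^sub>C lam a"
    and "v \<equiv> ridge_v (mean_diff_cov x N\<^sub>T N\<^sub>C) \<Gamma> l lam a k"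
  assumes "prob_space P" and "W \<in> borel_measurable P"
    and "N\<^sub>T + N\<^sub>C = CARD('n)" and "N\<^sub>T = N\<^sub>C"
    and "positive_definite \<Sigma>" and "spectral_decomposition \<Sigma> \<Gamma> l"
    and "\<And>i j. i \<le> j \<Longrightarrow> l $ j \<le> l $ i" and "\<And>j. l $ j > 0"
    and "lam \<ge> 0" and "a > 0"
    and "distributed P lborel D (normal_vector_density 0 \<Sigma>)"
  shows "percent_reduction (prob_space.variance P (\<lambda>\<omega>. D \<omega> $ k))
           (prob_space.variance Q (\<lambda>\<omega>. D \<omega> $ k)) = 100 * (1 - v) \<and>
         v \<in> {0<..<1} \<and>
         prob_space.variance Q (\<lambda>\<omega>. D \<omega> $ k) < prob_space.variance P (\<lambda>\<omega>. D \<omega> $ k)"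
proof -
  interpret P: prob_space P by fact
  note spec = \<open>spectral_decomposition \<Sigma> \<Gamma> l\<close>
  note l = \<open>\<And>j. l $ j > 0\<close>
  let ?Z = "std_gauss (UNIV :: 'k set)"
  interpret Z: prob_space ?Z by (rule prob_space_std_gauss)
  have spZ: "space ?Z = UNIV" by (simp add: space_PiM)

  \<comment> \<open>The acceptance ellipsoid in Gaussian coordinates\<close>
  define c where "c j = l $ j / (l $ j + lam)" for j
  have c: "c j > 0" for j using l[of j] \<open>lam \<ge> 0\<close> by (simp add: c_def add_pos_nonneg)
  define A where "A = {z \<in> space ?Z. (\<Sum>j\<in>UNIV. c j * (z j)\<^sup>2) \<le> a}"
  have A[measurable]: "A \<in> sets ?Z" unfolding A_def by measurable
  define I where "I j = (\<integral>z. indicator A z * (z j)\<^sup>2 \<partial>?Z)" for j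
  have A_pos: "measure ?Z A > 0" and I_pos: "I j > 0" and I_less: "I j < measure ?Z A" for j
    using std_gauss_ellipsoid_second_moment(1)[of c a]
      std_gauss_ellipsoid_second_moment(2,3)[of c a j] c \<open>a > 0\<close> by (auto simp: A_def I_def)
  have d: "ridge_d l lam a j = I j / measure ?Z A" for j
    unfolding ridge_d_def Let_def c_def[symmetric] A_def[symmetric] I_def
    by (rule integral_uniform_measure[OF prob_space_std_gauss]) (use A_pos in auto)

  \<comment> \<open>The law of the mean difference\<close>
  define T where "T z = \<Gamma> *v (\<chi> i. sqrt (l $ i) * z i)" for z
  have T[measurable]: "T \<in> borel_measurable (PiM UNIV (\<lambda>_. borel))"
  proof -
    have "(\<lambda>z i. sqrt (l $ i) * z i) \<in> PiM UNIV (\<lambda>_. borel) \<rightarrow>\<^sub>M PiM UNIV (\<lambda>_. borel)"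
      by (rule measurable_PiM_single') (auto simp: space_PiM)
    then show ?thesis unfolding T_def by measurable
  qed
  have distr_T: "distr P borel D = distr ?Z borel T"
  proof -
    have "distr P borel D = distr P lborel D" by (rule distr_cong) auto
    also have "\<dots> = density lborel (normal_vector_density 0 \<Sigma>)"
      by (rule distributed_distr_eq_density) fact
    also have "\<dots> = distr ?Z borel T"
      unfolding T_def by (rule distr_std_gauss_spectral[OF spec l, symmetric])
    finally show ?thesis .
  qed
  have D[measurable]: "D \<in> borel_measurable P"
    using \<open>distributed P lborel D (normal_vector_density 0 \<Sigma>)\<close>
    by (auto simp: distributed_def)
  have transfer: "(\<integral>\<omega>. f (D \<omega>) \<partial>P) = (\<integral>z. f (T z) \<partial>?Z)"
    if [measurable]: "f \<in> borel_measurable borel" for f :: "_ \<Rightarrow> real"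
  proof -
    have "(\<integral>\<omega>. f (D \<omega>) \<partial>P) = (\<integral>y. f y \<partial>distr P borel D)"
      by (rule integral_distr[symmetric]) auto
    also have "\<dots> = (\<integral>z. f (T z) \<partial>?Z)"
      unfolding distr_T by (rule integral_distr) auto
    finally show ?thesis .
  qed

  \<comment> \<open>The acceptance event\<close>
  define E where "E = {y. y \<bullet> (matrix_inv (\<Sigma> + lam *\<^sub>R mat 1) *v y) \<le> a}"
  have E[measurable]: "E \<in> sets borel" unfolding E_def by measurable
  \<comment> \<open>The square of \<open>sqrt (l $ i) * z i\<close> over the shifted eigenvalue
    \<open>l $ i + lam\<close> is exactly \<open>c i * (z i)\<^sup>2\<close>.\<close>
  have T_E: "T z \<in> E \<longleftrightarrow> z \<in> A" for z
  proof -
    have "T z \<bullet> (matrix_inv (\<Sigma> + lam *\<^sub>R mat 1) *v T z) =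
        (\<Sum>i\<in>UNIV. (sqrt (l $ i) * z i)\<^sup>2 / (l $ i + lam))"
      unfolding T_def using l \<open>lam \<ge> 0\<close>
      by (subst spectral_decomposition_matrix_inv[OF spectral_decomposition_shift[OF spec]])
         (auto simp: add_pos_nonneg less_imp_neq[symmetric])
    also have "\<dots> = (\<Sum>i\<in>UNIV. c i * (z i)\<^sup>2)"
      using l by (intro sum.cong refl) (simp add: c_def power_mult_distrib less_imp_le)
    finally show ?thesis by (simp add: E_def A_def spZ)
  qed
  define B where "B = {\<omega> \<in> space P. D \<omega> \<in> E}"
  have B[measurable]: "B \<in> sets P" unfolding B_def by measurable
  \<comment> \<open>The distance depends on the assignment only through \<open>D\<close>, so
    acceptance is the preimage of a set of vectors.\<close>
  have Q: "Q = uniform_measure P B"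
    by (simp add: Q_def ridge_rerandomized_def ridge_mahalanobis_def B_def E_def D_def \<Sigma>_def)
  have prob_B: "measure P B = measure ?Z A"
  proof -
    have "measure P B = measure (distr P borel D) E"
      by (subst measure_distr) (auto simp: B_def vimage_def Int_def conj_commute)
    also have "\<dots> = measure ?Z A"
      unfolding distr_T by (subst measure_distr) (auto simp: T_E vimage_def spZ)
    finally show ?thesis .
  qed

  \<comment> \<open>Variance before and after conditioning\<close>
  define b where "b j = \<Gamma> $ k $ j * sqrt (l $ j)" for j
  have T_k: "T z $ k = (\<Sum>j\<in>UNIV. b j * z j)" for z
    by (simp add: T_def b_def matrix_vector_mult_def mult_ac)
  have b_sq: "(b j)\<^sup>2 = (\<Gamma> $ k $ j)\<^sup>2 * l $ j" for j
    using l[of j] by (simp add: b_def power_mult_distrib less_imp_le)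
  have flip_A: "flip i z \<in> A \<longleftrightarrow> z \<in> A" for i z
    by (simp add: A_def spZ flip_square)
  have "UNIV \<in> sets (PiM UNIV (\<lambda>_::'k. borel :: real measure))"
    using sets.top[of "PiM UNIV (\<lambda>_::'k. borel :: real measure)"] by (simp add: space_PiM)
  then have full: "(\<integral>z. (\<Sum>j\<in>UNIV. b j * z j) \<partial>?Z) = 0"
    "(\<integral>z. (\<Sum>j\<in>UNIV. b j * z j)\<^sup>2 \<partial>?Z) = (\<Sum>j\<in>UNIV. (b j)\<^sup>2)"
    using integral_std_gauss_linear_form[of UNIV b] by (simp_all add: integral_std_gauss_square)
  note trunc = integral_std_gauss_linear_form[of A b, OF flip_A A[unfolded sets_std_gauss]]

  \<comment> \<open>The mean vanishes, so the variance is the second moment; the same happens below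
    under \<open>Q\<close>.\<close>
  have "(\<integral>\<omega>. D \<omega> $ k \<partial>P) = 0"
    by (subst transfer[of "\<lambda>y. y $ k"]) (auto simp: T_k full)
  then have var_P: "P.variance (\<lambda>\<omega>. D \<omega> $ k) = (\<Sum>j\<in>UNIV. (b j)\<^sup>2)"
    using transfer[of "\<lambda>y. (y $ k)\<^sup>2"] by (simp add: T_k full)

  have transfer_Q: "(\<integral>\<omega>. f (D \<omega>) \<partial>Q) = (\<integral>z. indicator A z * f (T z) \<partial>?Z) / measure ?Z A"
    if [measurable]: "f \<in> borel_measurable borel" for f :: "_ \<Rightarrow> real"
  proof -
    have "(\<integral>\<omega>. f (D \<omega>) \<partial>Q) = (\<integral>\<omega>. indicator B \<omega> * f (D \<omega>) \<partial>P) / measure P B"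
      unfolding Q by (rule integral_uniform_measure) (use A_pos prob_B in \<open>auto intro: P.prob_space_axioms\<close>)
    also have "(\<integral>\<omega>. indicator B \<omega> * f (D \<omega>) \<partial>P) = (\<integral>\<omega>. indicator E (D \<omega>) * f (D \<omega>) \<partial>P)"
      by (intro Bochner_Integration.integral_cong) (auto simp: B_def indicator_def)
    also have "\<dots> = (\<integral>z. indicator E (T z) * f (T z) \<partial>?Z)"
      by (rule transfer[of "\<lambda>y. indicator E y * f y"]) measurable
    finally show ?thesis by (simp add: prob_B indicator_def T_E)
  qed
  have "(\<integral>\<omega>. D \<omega> $ k \<partial>Q) = 0"
    by (subst transfer_Q[of "\<lambda>y. y $ k"]) (auto simp: T_k trunc)
  then have var_Q: "prob_space.variance Q (\<lambda>\<omega>. D \<omega> $ k) =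
      (\<Sum>j\<in>UNIV. (b j)\<^sup>2 * ridge_d l lam a j)"
    using transfer_Q[of "\<lambda>y. (y $ k)\<^sup>2"]
    by (simp add: T_k trunc d I_def sum_divide_distrib)

  \<comment> \<open>The ratio of the variances\<close>
  have \<Sigma>_kk: "\<Sigma> $ k $ k = (\<Sum>j\<in>UNIV. (b j)\<^sup>2)"
    using spec by (simp add: spectral_decomposition_def conjugated_diag_entry b_sq)
  \<comment> \<open>The diagonal entry of \<open>\<Sigma>\<close> is the unconditional variance, so
    \<open>v\<close> is the quotient of the two variances.\<close>
  have v: "v = (\<Sum>j\<in>UNIV. (b j)\<^sup>2 * ridge_d l lam a j) / (\<Sum>j\<in>UNIV. (b j)\<^sup>2)"
    by (simp add: v_def ridge_v_def \<Sigma>_def[symmetric] \<Sigma>_kk conjugated_diag_entry b_sq mult_ac)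
  have d_pos: "ridge_d l lam a j > 0" and d_less: "ridge_d l lam a j < 1" for j
    using A_pos I_pos[of j] I_less[of j] by (simp_all add: d)
  \<comment> \<open>Positive definiteness tested on the \<open>k\<close>-th unit vector makes the
    diagonal entry positive, so some coefficient is nonzero; at that index the bounds on
    \<open>ridge_d\<close> make the comparison of sums strict.\<close>
  obtain i where i: "b i \<noteq> 0"
  proof -
    have "axis k 1 \<noteq> (0 :: (real, 'k) vec)" by (simp add: axis_eq_0_iff)
    then have "0 < axis k 1 \<bullet> (\<Sigma> *v axis k 1)"
      using \<open>positive_definite \<Sigma>\<close> by (auto simp: positive_definite_def)
    then have "(\<Sum>j\<in>UNIV. (b j)\<^sup>2) \<noteq> 0"
      by (simp add: inner_axis' matrix_vector_mult_basis column_def \<Sigma>_kk)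
    then show ?thesis using that by (metis sum.neutral power_zero_numeral)
  qed
  have S_pos: "(\<Sum>j\<in>UNIV. (b j)\<^sup>2) > 0"
    using i by (intro sum_pos2[of _ i]) auto
  have num_pos: "(\<Sum>j\<in>UNIV. (b j)\<^sup>2 * ridge_d l lam a j) > 0"
    using i d_pos by (intro sum_pos2[of _ i]) (auto simp: less_imp_le)
  have num_less: "(\<Sum>j\<in>UNIV. (b j)\<^sup>2 * ridge_d l lam a j) < (\<Sum>j\<in>UNIV. (b j)\<^sup>2)"
  proof (rule sum_strict_mono_ex1)
    show "\<forall>j\<in>UNIV. (b j)\<^sup>2 * ridge_d l lam a j \<le> (b j)\<^sup>2"
      using d_less by (auto intro!: mult_left_le simp: less_imp_le)
    show "\<exists>j\<in>UNIV. (b j)\<^sup>2 * ridge_d l lam a j < (b j)\<^sup>2"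
      using i d_less[of i] by (intro bexI[of _ i]) auto
  qed simp
  show ?thesis
    unfolding var_P var_Q v percent_reduction_def
    using S_pos num_pos num_less by (auto simp: field_simps)
qed

end
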